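(* Let $F\in C^2(\mathbb R^n\times\mathbb R^m,\mathbb R)$, let $(x^\star,z^\star)$ be a saddle point of $F$ solving $\max_{z\in\mathbb R^m}\min_{x\in\mathbb R^n}F(x,z)$, and suppose that $F$ is locally strictly convex-concave on an open neighborhood $U\subset\mathbb R^n\times\mathbb R^m$ of $(x^\star,z^\star)$, with $\nabla_{xx}F(x,z)\succ0$ and $\nabla_{zz}F(x,z)\prec0$ for all $(x,z)\in U$. Let $c_1,c_2>0$, $p_1>2$, $1<p_2<2$, and consider $$\begin{bmatrix}\dot x\\ \dot z\end{bmatrix}=-(\nabla^2F(x,z))^{-1}\left(c_1\frac{\nabla F(x,z)}{\|\nabla F(x,z)\|^{\frac{p_1-2}{p_1-1}}}+c_2\frac{\nabla F(x,z)}{\|\nabla F(x,z)\|^{\frac{p_2-2}{p_2-1}}}\right).$$ Let $V(x,z)=\frac12\|\nabla F(x,z)\|^2$ and let $D\subset U$ be the largest compact sub-level set of $V$ in $U$. Then the trajectories converge to $(x^\star,z^\star)$ in a fixed time $T_{SP}$ for all $(x(0),z(0))\in D$; that is, there is $T_{SP}<\infty$, independent of the initial condition in $D$, such that $(x(t),z(t))=(x^\star,z^\star)$ for all $t\ge T_{SP}$. Furthermore, if $U=\mathbb R^n\times\mathbb R^m$, then the result holds for all $(x(0),z(0))\in\mathbb R^n\times\mathbb R^m$.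
   Context: $\|\cdot\|$ is the Euclidean norm, $\nabla F=[\nabla_xF^T\ \ \nabla_zF^T]^T$, and $\nabla^2F$ is the full Hessian of $F$ in $(x,z)$. $(x^\star,z^\star)$ is a (local) saddle point if there are open neighborhoods $N_x$ of $x^\star$ and $N_z$ of $z^\star$ with $F(x^\star,z)\le F(x^\star,z^\star)\le F(x,z^\star)$ for all $(x,z)\in N_x\times N_z$; it is then also called a local optimal solution of the max-min problem. Locally strictly convex-concave on $U$ means: $U=U_x\times U_z$ with $U_x,U_z$ convex, for each fixed $\bar z\in U_z$ the function $F(\cdot,\bar z)$ is strictly convex on $U_x$, and for each fixed $\bar x\in U_x$ the function $F(\bar x,\cdot)$ is strictly concave on $U_z$. A sub-level set of $V$ in $U$ is a set $\{(x,z)\in U: V(x,z)\le c\}$ with $c\ge 0$. Convention: the right-hand side of the differential equation is defined to be $0$ where $\nabla F(x,z)=0$. A trajectory is a solution defined for $t\ge0$. *)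

theory Defs
  imports "HOL-Analysis.Analysis"
begin

definition grad :: "('a::euclidean_space \<Rightarrow> real) \<Rightarrow> 'a \<Rightarrow> 'a" where
  "grad f p = (THE g. GDERIV f p :> g)"

(* The Hessian is represented as a linear operator, the Frechet derivative of the gradient.
   Its quadratic form is h \<bullet> hessian f p h, and the matrix inverse is the inverse function. *)

definition hessian :: "('a::euclidean_space \<Rightarrow> real) \<Rightarrow> 'a \<Rightarrow> 'a \<Rightarrow> 'a" where
  "hessian f p = frechet_derivative (grad f) (at p)"

definition C2 :: "('a::euclidean_space \<Rightarrow> real) \<Rightarrow> bool" where
  "C2 f \<longleftrightarrow> (\<exists>G (H :: 'a \<Rightarrow> 'a \<Rightarrow>\<^sub>L 'a).
     (\<forall>p. GDERIV f p :> G p) \<and>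
     (\<forall>p. (G has_derivative blinfun_apply (H p)) (at p)) \<and>
     continuous_on UNIV H)"

definition pos_def :: "('a::real_inner \<Rightarrow> 'a) \<Rightarrow> bool" where
  "pos_def A \<longleftrightarrow> (\<forall>h. h \<noteq> 0 \<longrightarrow> h \<bullet> A h > 0)"

definition neg_def :: "('a::real_inner \<Rightarrow> 'a) \<Rightarrow> bool" where
  "neg_def A \<longleftrightarrow> (\<forall>h. h \<noteq> 0 \<longrightarrow> h \<bullet> A h < 0)"

definition hessian_xx ::
  "('a::euclidean_space \<times> 'b::euclidean_space \<Rightarrow> real) \<Rightarrow> 'a \<times> 'b \<Rightarrow> 'a \<Rightarrow> 'a" where
  "hessian_xx F p = hessian (\<lambda>x. F (x, snd p)) (fst p)"

definition hessian_zz ::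
  "('a::euclidean_space \<times> 'b::euclidean_space \<Rightarrow> real) \<Rightarrow> 'a \<times> 'b \<Rightarrow> 'b \<Rightarrow> 'b" where
  "hessian_zz F p = hessian (\<lambda>z. F (fst p, z)) (snd p)"

definition strictly_convex_on :: "'a::real_vector set \<Rightarrow> ('a \<Rightarrow> real) \<Rightarrow> bool" where
  "strictly_convex_on S f \<longleftrightarrow> convex S \<and>
     (\<forall>x\<in>S. \<forall>y\<in>S. \<forall>t. x \<noteq> y \<and> 0 < t \<and> t < 1 \<longrightarrow>
        f ((1 - t) *\<^sub>R x + t *\<^sub>R y) < (1 - t) * f x + t * f y)"

definition strictly_concave_on :: "'a::real_vector set \<Rightarrow> ('a \<Rightarrow> real) \<Rightarrow> bool" where
  "strictly_concave_on S f \<longleftrightarrow> strictly_convex_on S (\<lambda>x. - f x)"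

definition strictly_convex_concave_on ::
  "('a::real_vector \<times> 'b::real_vector) set \<Rightarrow> ('a \<times> 'b \<Rightarrow> real) \<Rightarrow> bool" where
  "strictly_convex_concave_on U F \<longleftrightarrow> (\<exists>Ux Uz. U = Ux \<times> Uz \<and> convex Ux \<and> convex Uz \<and>
     (\<forall>z\<in>Uz. strictly_convex_on Ux (\<lambda>x. F (x, z))) \<and>
     (\<forall>x\<in>Ux. strictly_concave_on Uz (\<lambda>z. F (x, z))))"

definition saddle_point ::
  "('a::topological_space \<times> 'b::topological_space \<Rightarrow> real) \<Rightarrow> 'a \<Rightarrow> 'b \<Rightarrow> bool" where
  "saddle_point F xs zs \<longleftrightarrow> (\<exists>Nx Nz. open Nx \<and> xs \<in> Nx \<and> open Nz \<and> zs \<in> Nz \<and>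
     (\<forall>x\<in>Nx. \<forall>z\<in>Nz. F (xs, z) \<le> F (xs, zs) \<and> F (xs, zs) \<le> F (x, zs)))"

definition lyapunov :: "('a::euclidean_space \<Rightarrow> real) \<Rightarrow> 'a \<Rightarrow> real" where
  "lyapunov F p = (norm (grad F p))\<^sup>2 / 2"

definition sublevel_set :: "('a \<Rightarrow> real) \<Rightarrow> 'a set \<Rightarrow> 'a set \<Rightarrow> bool" where
  "sublevel_set V U S \<longleftrightarrow> (\<exists>c\<ge>0. S = {p \<in> U. V p \<le> c})"

(* The union of all compact sub-level sets is the largest one whenever a largest one exists
   (lemma below). If the supremum of the admissible levels is not attained, as for
   V p = (norm p)^2 / 2 on an open ball, it is the increasing union of all of them,
   so that no statement about this set is vacuous. *)

definition largest_compact_sublevel_set ::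
  "('a::topological_space \<Rightarrow> real) \<Rightarrow> 'a set \<Rightarrow> 'a set" where
  "largest_compact_sublevel_set V U = \<Union>{S. sublevel_set V U S \<and> compact S}"

lemma largest_compact_sublevel_set_eqI:
  assumes "sublevel_set V U S" "compact S"
    and "\<And>S'. sublevel_set V U S' \<Longrightarrow> compact S' \<Longrightarrow> S' \<subseteq> S"
  shows "largest_compact_sublevel_set V U = S"
  using assms unfolding largest_compact_sublevel_set_def by blast

lemma largest_compact_sublevel_set_subset: "largest_compact_sublevel_set V U \<subseteq> U"
  unfolding largest_compact_sublevel_set_def sublevel_set_def by blast

definition newton_field ::
  "('a::euclidean_space \<Rightarrow> real) \<Rightarrow> real \<Rightarrow> real \<Rightarrow> real \<Rightarrow> real \<Rightarrow> 'a \<Rightarrow> 'a" where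
  "newton_field F c1 c2 p1 p2 w =
     (let g = grad F w in
      if g = 0 then 0
      else - inv (hessian F w)
             (c1 *\<^sub>R (g /\<^sub>R (norm g powr ((p1 - 2) / (p1 - 1)))) +
              c2 *\<^sub>R (g /\<^sub>R (norm g powr ((p2 - 2) / (p2 - 1))))))"

(* Only the values on {0..} matter; the derivative at 0 is one-sided. *)

definition trajectory :: "('a::real_normed_vector \<Rightarrow> 'a) \<Rightarrow> (real \<Rightarrow> 'a) \<Rightarrow> bool" where
  "trajectory f w \<longleftrightarrow> (\<forall>t\<ge>0. (w has_vector_derivative f (w t)) (at t within {0..}))"

definition fixed_time_convergent ::
  "('a::real_normed_vector \<Rightarrow> 'a) \<Rightarrow> 'a set \<Rightarrow> 'a \<Rightarrow> bool" where
  "fixed_time_convergent f D q \<longleftrightarrow>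
     (\<exists>T\<ge>0. \<forall>w. trajectory f w \<and> w 0 \<in> D \<longrightarrow> (\<forall>t\<ge>T. w t = q))"

end

theory Submission
  imports Defs
begin

text \<open>
  Along a trajectory \<open>w\<close> inside \<open>U\<close> the gradient \<open>g = \<nabla>F(w)\<close> obeys an equation that no longer
  mentions \<open>F\<close>: by the chain rule \<open>g' = \<nabla>\<^sup>2F(w) w'\<close>, and the inverse Hessian in the field cancels, so
  that \<open>g' = -(c1 \<parallel>g\<parallel>\<^sup>-\<^sup>\<alpha> + c2 \<parallel>g\<parallel>\<^sup>-\<^sup>\<beta>) g\<close> with \<open>\<alpha> = (p1-2)/(p1-1)\<close> and \<open>\<beta> = (p2-2)/(p2-1)\<close>. Hence
  \<open>V = \<parallel>g\<parallel>\<^sup>2/2\<close> satisfies the scalar equation \<open>V' = -(k1 V\<^sup>a + k2 V\<^sup>b)\<close> with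
  \<open>a = p1/(2(p1-1)) < 1 < b = p2/(2(p2-1))\<close>. The superlinear term brings \<open>V\<close> from any height below 1
  within a time that does not depend on the height, and the sublinear term brings it from there to
  0 in finite time (\<open>fixed_time_extinction\<close>).

  Cancelling needs an invertible Hessian. Its blocks are definite of opposite signs; since the
  Hessian is symmetric, the off-diagonal blocks cancel in \<open>(h, -k) \<bullet> \<nabla>\<^sup>2F (h, k)\<close>, which is therefore
  positive for \<open>(h, k) \<noteq> 0\<close> (\<open>hessian_surj_of_definite_blocks\<close>).

  After the gradient has vanished, the trajectory sits at a critical point in \<open>U\<close>. The saddle point
  is one such point, and strict convexity-concavity allows no second one
  (\<open>strictly_convex_concave_critical_point_unique\<close>).

  It remains to see that trajectories do not leave \<open>U\<close>. If \<open>U\<close> is the whole space this is void;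
  otherwise a trajectory that starts in a compact sub-level set of \<open>V\<close> stays in it, because \<open>V\<close>
  decreases as long as the trajectory is in the open set \<open>U\<close>
  (\<open>compact_sublevel_set_forward_invariant\<close>). The time bound depends on \<open>c1, c2, p1, p2\<close> only, so it
  serves all these sub-level sets at once, and hence their union.
\<close>

section \<open>Gradient and Hessian of a twice continuously differentiable function\<close>

lemma grad_eqI:
  assumes "GDERIV f p :> g"
  shows "grad f p = g"
  unfolding grad_def
proof (rule the_equality)
  fix g' assume "GDERIV f p :> g'"
  then have "(\<lambda>h. h \<bullet> g') = (\<lambda>h. h \<bullet> g)"
    using assms has_derivative_unique unfolding gderiv_def by blast
  then show "g' = g" by (metis vector_eq_ldot)
qed fact

lemma C2_GDERIV:
  assumes "C2 F"
  shows "GDERIV F p :> grad F p"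
  using assms grad_eqI unfolding C2_def by metis

lemma C2_grad_has_derivative:
  assumes "C2 F"
  shows "(grad F has_derivative hessian F p) (at p)"
proof -
  obtain G H where G: "\<And>p. GDERIV F p :> G p"
    and H: "\<And>p. (G has_derivative blinfun_apply (H p)) (at p)"
    using assms unfolding C2_def by blast
  have "grad F = G" using grad_eqI[OF G] by blast
  then show ?thesis using H[of p] frechet_derivative_at[OF H[of p]] by (simp add: hessian_def)
qed

lemma C2_continuous_hessian:
  assumes "C2 F"
  shows "continuous_on UNIV (\<lambda>p. u \<bullet> hessian F p v)"
proof -
  obtain G and H :: "'a \<Rightarrow> 'a \<Rightarrow>\<^sub>L 'a" where G: "\<And>p. GDERIV F p :> G p"
    and H: "\<And>p. (G has_derivative blinfun_apply (H p)) (at p)" and c: "continuous_on UNIV H"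
    using assms unfolding C2_def by blast
  have "grad F = G" using grad_eqI[OF G] by blast
  then have "hessian F p = blinfun_apply (H p)" for p
    using frechet_derivative_at[OF H[of p]] by (simp add: hessian_def)
  then show ?thesis by (auto intro!: continuous_intros c)
qed

text \<open>
  The second difference is symmetric in \<open>u\<close> and \<open>v\<close>, but taking the mean value theorem first in the
  direction \<open>u\<close> and then in the direction \<open>v\<close> expresses it by one entry of the Hessian. Comparing
  both orders as \<open>s \<rightarrow> 0\<close> gives the symmetry of second derivatives.
\<close>
lemma second_difference_mean_value:
  assumes "C2 F" "s > 0"
  obtains \<xi> \<eta> where "0 < \<xi>" "\<xi> < s" "0 < \<eta>" "\<eta> < s"
    "F (p + s *\<^sub>R u + s *\<^sub>R v) - F (p + s *\<^sub>R u) - F (p + s *\<^sub>R v) + F p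
      = s\<^sup>2 * (u \<bullet> hessian F (p + \<xi> *\<^sub>R u + \<eta> *\<^sub>R v) v)"
proof -
  have dF: "(F has_derivative (\<lambda>h. h \<bullet> grad F q)) (at q)" for q
    using C2_GDERIV[OF assms(1)] unfolding gderiv_def .
  have dG: "(grad F has_derivative hessian F q) (at q)" for q
    by (rule C2_grad_has_derivative[OF assms(1)])
  define \<phi> where "\<phi> \<tau> = F (p + \<tau> *\<^sub>R u + s *\<^sub>R v) - F (p + \<tau> *\<^sub>R u)" for \<tau>
  define \<phi>' where "\<phi>' \<tau> = u \<bullet> (grad F (p + \<tau> *\<^sub>R u + s *\<^sub>R v) - grad F (p + \<tau> *\<^sub>R u))" for \<tau>
  have "(\<phi> has_real_derivative \<phi>' \<tau>) (at \<tau>)" for \<tau>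
    unfolding \<phi>_def \<phi>'_def has_field_derivative_def
    by (rule has_derivative_eq_rhs, (rule derivative_intros has_derivative_compose[OF _ dF])+)
      (auto simp: algebra_simps inner_simps)
  from MVT2[OF \<open>s > 0\<close> this] obtain \<xi> where \<xi>: "0 < \<xi>" "\<xi> < s" "\<phi> s - \<phi> 0 = s * \<phi>' \<xi>"
    by auto
  define \<psi> where "\<psi> \<tau> = u \<bullet> grad F (p + \<xi> *\<^sub>R u + \<tau> *\<^sub>R v)" for \<tau>
  have lin: "hessian F q (k *\<^sub>R v) = k *\<^sub>R hessian F q v" for q k
    using dG has_derivative_linear linear_scale by blast
  have "(\<psi> has_real_derivative (u \<bullet> hessian F (p + \<xi> *\<^sub>R u + \<tau> *\<^sub>R v) v)) (at \<tau>)" for \<tau>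
    unfolding \<psi>_def has_field_derivative_def
    by (rule has_derivative_eq_rhs, (rule derivative_intros has_derivative_compose[OF _ dG])+)
      (auto simp: lin)
  from MVT2[OF \<open>s > 0\<close> this] obtain \<eta> where \<eta>: "0 < \<eta>" "\<eta> < s"
    "\<psi> s - \<psi> 0 = s * (u \<bullet> hessian F (p + \<xi> *\<^sub>R u + \<eta> *\<^sub>R v) v)"
    by auto
  have "\<phi>' \<xi> = \<psi> s - \<psi> 0" by (simp add: \<phi>'_def \<psi>_def inner_diff_right)
  then show ?thesis
    using that[of \<xi> \<eta>] \<xi> \<eta> by (simp add: \<phi>_def power2_eq_square algebra_simps)
qed

lemma hessian_symmetric:
  assumes "C2 F"
  shows "u \<bullet> hessian F p v = v \<bullet> hessian F p u"
proof -
  have half: "((\<lambda>s. (F (p + s *\<^sub>R u + s *\<^sub>R v) - F (p + s *\<^sub>R u) - F (p + s *\<^sub>R v) + F p) / s\<^sup>2)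
      \<longlongrightarrow> u \<bullet> hessian F p v) (at_right 0)" (is "(?q \<longlongrightarrow> _) _") for u v
  proof -
    have "\<exists>\<xi> \<eta>. 0 < \<xi> \<and> \<xi> < s \<and> 0 < \<eta> \<and> \<eta> < s \<and>
        ?q s = u \<bullet> hessian F (p + \<xi> *\<^sub>R u + \<eta> *\<^sub>R v) v" if "s > 0" for s
      using second_difference_mean_value[OF assms that, of p u v] that
      by (metis nonzero_mult_div_cancel_left power_not_zero less_irrefl)
    then obtain \<xi> \<eta> where m: "\<And>s. s > 0 \<Longrightarrow> 0 < \<xi> s \<and> \<xi> s < s \<and> 0 < \<eta> s \<and> \<eta> s < s \<and>
        ?q s = u \<bullet> hessian F (p + \<xi> s *\<^sub>R u + \<eta> s *\<^sub>R v) v"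
      by metis
    have pos: "\<forall>\<^sub>F s::real in at_right 0. s > 0" by (simp add: eventually_at_right_less)
    have "(\<xi> \<longlongrightarrow> 0) (at_right 0)" "(\<eta> \<longlongrightarrow> 0) (at_right 0)"
      by (rule tendsto_sandwich[of "\<lambda>_. 0" _ _ "\<lambda>s. s"];
          use m in \<open>auto intro!: eventually_mono[OF pos] tendsto_eq_intros less_imp_le\<close>)+
    then have "((\<lambda>s. p + \<xi> s *\<^sub>R u + \<eta> s *\<^sub>R v) \<longlongrightarrow> p) (at_right 0)"
      by (auto intro!: tendsto_eq_intros)
    then have "((\<lambda>s. u \<bullet> hessian F (p + \<xi> s *\<^sub>R u + \<eta> s *\<^sub>R v) v) \<longlongrightarrow> u \<bullet> hessian F p v) (at_right 0)"
      by (rule isCont_tendsto_compose[rotated])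
        (use C2_continuous_hessian[OF assms] in \<open>simp add: continuous_on_eq_continuous_at\<close>)
    moreover have "\<forall>\<^sub>F s in at_right 0. u \<bullet> hessian F (p + \<xi> s *\<^sub>R u + \<eta> s *\<^sub>R v) v = ?q s"
      using pos by (rule eventually_mono) (metis m)
    ultimately show ?thesis by (rule Lim_transform_eventually)
  qed
  have "((\<lambda>s. (F (p + s *\<^sub>R u + s *\<^sub>R v) - F (p + s *\<^sub>R u) - F (p + s *\<^sub>R v) + F p) / s\<^sup>2)
      \<longlongrightarrow> v \<bullet> hessian F p u) (at_right 0)"
    using half[of v u] by (simp add: algebra_simps)
  from tendsto_unique[OF _ half[of u v] this] show ?thesis by simp
qed

lemma C2_GDERIV_slices:
  fixes F :: "'a::euclidean_space \<times> 'b::euclidean_space \<Rightarrow> real"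
  assumes "C2 F"
  shows "GDERIV (\<lambda>x. F (x, z)) x :> fst (grad F (x, z))"
    and "GDERIV (\<lambda>z. F (x, z)) z :> snd (grad F (x, z))"
proof -
  have dF: "(F has_derivative (\<lambda>h. h \<bullet> grad F q)) (at q)" for q
    using C2_GDERIV[OF assms] unfolding gderiv_def .
  show "GDERIV (\<lambda>x. F (x, z)) x :> fst (grad F (x, z))"
    unfolding gderiv_def
    by (rule has_derivative_eq_rhs, rule has_derivative_compose[OF _ dF],
        (rule derivative_intros)+) (simp add: inner_prod_def)
  show "GDERIV (\<lambda>z. F (x, z)) z :> snd (grad F (x, z))"
    unfolding gderiv_def
    by (rule has_derivative_eq_rhs, rule has_derivative_compose[OF _ dF],
        (rule derivative_intros)+) (simp add: inner_prod_def)
qed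

text \<open>
  The definiteness assumptions speak of Hessians of slices; these are the diagonal blocks of the
  full Hessian.
\<close>
lemma hessian_blocks:
  fixes F :: "'a::euclidean_space \<times> 'b::euclidean_space \<Rightarrow> real"
  assumes "C2 F"
  shows "hessian_xx F p h = fst (hessian F p (h, 0))"
    and "hessian_zz F p k = snd (hessian F p (0, k))"
proof -
  have dG: "(grad F has_derivative hessian F q) (at q)" for q
    by (rule C2_grad_has_derivative[OF assms])
  have "((\<lambda>x. fst (grad F (x, snd p))) has_derivative (\<lambda>h. fst (hessian F p (h, 0)))) (at (fst p))"
    by (rule has_derivative_eq_rhs, rule derivative_intros,
        rule has_derivative_compose[OF _ dG], (rule derivative_intros)+) simp
  moreover have "grad (\<lambda>x. F (x, snd p)) = (\<lambda>x. fst (grad F (x, snd p)))"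
    using grad_eqI[OF C2_GDERIV_slices(1)[OF assms]] by blast
  ultimately show "hessian_xx F p h = fst (hessian F p (h, 0))"
    unfolding hessian_xx_def hessian_def
    by (metis (no_types, lifting) frechet_derivative_at hessian_def)
  have "((\<lambda>z. snd (grad F (fst p, z))) has_derivative (\<lambda>k. snd (hessian F p (0, k)))) (at (snd p))"
    by (rule has_derivative_eq_rhs, rule derivative_intros,
        rule has_derivative_compose[OF _ dG], (rule derivative_intros)+) simp
  moreover have "grad (\<lambda>z. F (fst p, z)) = (\<lambda>z. snd (grad F (fst p, z)))"
    using grad_eqI[OF C2_GDERIV_slices(2)[OF assms]] by blast
  ultimately show "hessian_zz F p k = snd (hessian F p (0, k))"
    unfolding hessian_zz_def hessian_def
    by (metis (no_types, lifting) frechet_derivative_at hessian_def)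
qed

text \<open>
  A symmetric block matrix with diagonal blocks \<open>A\<close> positive definite and \<open>C\<close> negative definite is
  invertible: testing a null vector \<open>(h, k)\<close> with \<open>(h, -k)\<close> removes the off-diagonal blocks and leaves
  \<open>h \<bullet> A h - k \<bullet> C k = 0\<close>.
\<close>
lemma hessian_surj_of_definite_blocks:
  fixes F :: "'a::euclidean_space \<times> 'b::euclidean_space \<Rightarrow> real"
  assumes "C2 F" and xx: "pos_def (hessian_xx F p)" and zz: "neg_def (hessian_zz F p)"
  shows "surj (hessian F p)"
proof -
  have lin: "linear (hessian F p)"
    using C2_grad_has_derivative[OF assms(1)] has_derivative_linear by blast
  have "w = 0" if "hessian F p w = 0" for w
  proof -
    obtain h k where w: "w = (h, k)" by (cases w)
    let ?H = "hessian F p"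
    have "(h, k) = (h, 0) + (0, k)" by simp
    then have sum0: "?H (h, 0) + ?H (0, k) = 0"
      using that lin w by (metis linear_add)
    have "(h, 0) \<bullet> ?H (h, 0) - (0, k) \<bullet> ?H (0, k)
        = ((h, 0) - (0, k)) \<bullet> (?H (h, 0) + ?H (0, k))"
      using hessian_symmetric[OF assms(1), of "(h, 0)" p "(0, k)"]
      by (simp add: inner_diff_left inner_add_right del: diff_Pair)
    then have "h \<bullet> hessian_xx F p h - k \<bullet> hessian_zz F p k = 0"
      using sum0 by (simp add: inner_prod_def hessian_blocks[OF assms(1)])
    moreover have "h \<noteq> 0 \<Longrightarrow> h \<bullet> hessian_xx F p h > 0" "k \<noteq> 0 \<Longrightarrow> k \<bullet> hessian_zz F p k < 0"
      using xx zz unfolding pos_def_def neg_def_def by auto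
    ultimately show "w = 0" unfolding w by (cases "h = 0"; cases "k = 0") (auto simp: zero_prod_def)
  qed
  then have "inj (hessian F p)" using lin linear_injective_0 by blast
  with lin show ?thesis by (rule linear_inj_imp_surj)
qed


section \<open>Critical points of strictly convex-concave functions\<close>

text \<open>
  Comparing the chord from \<open>x\<close> to \<open>u\<close> with the vanishing directional derivative at \<open>x\<close> shows that \<open>x\<close>
  is a minimum on \<open>S\<close>; strictness at the midpoint of \<open>x\<close> and \<open>y\<close> then excludes equality.
\<close>
lemma strictly_convex_critical_point_less:
  fixes f :: "'a::euclidean_space \<Rightarrow> real"
  assumes "strictly_convex_on S f" "GDERIV f x :> 0" "x \<in> S" "y \<in> S" "y \<noteq> x"
  shows "f x < f y"
proof -
  have cvx: "f ((1 - t) *\<^sub>R x + t *\<^sub>R u) < (1 - t) * f x + t * f u"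
    if "u \<in> S" "u \<noteq> x" "0 < t" "t < 1" for u t
    using assms(1,3) that unfolding strictly_convex_on_def by simp
  have min: "f x \<le> f u" if u: "u \<in> S" "u \<noteq> x" for u
  proof -
    have dx: "(f has_derivative (\<lambda>h. 0)) (at (x + 0 *\<^sub>R (u - x)))"
      using assms(2) by (simp add: gderiv_def)
    have "((\<lambda>t. x + t *\<^sub>R (u - x)) has_derivative (\<lambda>t. t *\<^sub>R (u - x))) (at 0)"
      by (auto intro!: derivative_eq_intros)
    from has_derivative_compose[OF this dx]
    have "((\<lambda>t. f (x + t *\<^sub>R (u - x))) has_real_derivative 0) (at 0)"
      by (simp add: has_field_derivative_def lambda_zero)
    then have "((\<lambda>t. (f (x + t *\<^sub>R (u - x)) - f x) / t) \<longlongrightarrow> 0) (at_right 0)"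
      by (simp add: DERIV_def filterlim_at_split)
    moreover have "\<forall>\<^sub>F t in at_right 0. (f (x + t *\<^sub>R (u - x)) - f x) / t \<le> f u - f x"
      using eventually_at_right_real[of 0 1]
    proof (rule eventually_mono)
      fix t :: real assume t: "t \<in> {0<..<1}"
      have "x + t *\<^sub>R (u - x) = (1 - t) *\<^sub>R x + t *\<^sub>R u" by (simp add: algebra_simps)
      then have "f (x + t *\<^sub>R (u - x)) - f x \<le> t * (f u - f x)"
        using cvx[OF u, of t] t by (simp add: algebra_simps)
      then show "(f (x + t *\<^sub>R (u - x)) - f x) / t \<le> f u - f x"
        using t by (simp add: divide_le_eq mult.commute)
    qed simp
    ultimately have "0 \<le> f u - f x" by (rule tendsto_upperbound) simp
    then show ?thesis by simp
  qed
  define m where "m = (1 - 1/2) *\<^sub>R x + (1/2) *\<^sub>R y"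
  have "m \<in> S"
    using assms(1,3,4) unfolding strictly_convex_on_def m_def by (intro convexD_alt) auto
  then have "f x \<le> f m" using min by (cases "m = x") auto
  moreover have "f m < (1 - 1/2) * f x + (1/2) * f y"
    unfolding m_def by (rule cvx) (use assms(4,5) in auto)
  ultimately show ?thesis by simp
qed

lemma saddle_point_grad_eq_0:
  fixes F :: "'a::euclidean_space \<times> 'b::euclidean_space \<Rightarrow> real"
  assumes "C2 F" "saddle_point F xs zs"
  shows "grad F (xs, zs) = 0"
proof -
  obtain Nx Nz where N: "open Nx" "xs \<in> Nx" "open Nz" "zs \<in> Nz"
    and sad: "\<And>x z. x \<in> Nx \<Longrightarrow> z \<in> Nz \<Longrightarrow> F (xs, z) \<le> F (xs, zs) \<and> F (xs, zs) \<le> F (x, zs)"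
    using assms(2) unfolding saddle_point_def by blast
  have "(\<lambda>h. h \<bullet> fst (grad F (xs, zs))) = (\<lambda>h. 0)"
    using C2_GDERIV_slices(1)[OF assms(1), of zs xs] N sad unfolding gderiv_def
    by (intro differential_zero_maxmin[of xs Nx "\<lambda>x. F (x, zs)"]) auto
  moreover have "(\<lambda>k. k \<bullet> snd (grad F (xs, zs))) = (\<lambda>k. 0)"
    using C2_GDERIV_slices(2)[OF assms(1), of xs zs] N sad unfolding gderiv_def
    by (intro differential_zero_maxmin[of zs Nz "\<lambda>z. F (xs, z)"]) auto
  ultimately have "fst (grad F (xs, zs)) = 0" "snd (grad F (xs, zs)) = 0"
    using inner_eq_zero_iff by (meson fun_cong)+
  then show ?thesis by (simp add: prod_eq_iff)
qed

text \<open>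
  Two critical points \<open>(x, z)\<close> and \<open>(x', z')\<close> with both components different would give the cycle
  \<open>F(x, z) < F(x', z) < F(x', z') < F(x, z') < F(x, z)\<close>, in which each step moves away from or towards
  a critical point of a convex or concave slice. If one component agrees, two of the four
  inequalities remain and contradict each other.
\<close>
lemma strictly_convex_concave_critical_point_unique:
  fixes F :: "'a::euclidean_space \<times> 'b::euclidean_space \<Rightarrow> real"
  assumes "C2 F" "strictly_convex_concave_on U F" "p \<in> U" "q \<in> U" "grad F p = 0" "grad F q = 0"
  shows "p = q"
proof -
  obtain Ux Uz where U: "U = Ux \<times> Uz"
    and cvx: "\<And>z. z \<in> Uz \<Longrightarrow> strictly_convex_on Ux (\<lambda>x. F (x, z))"
    and ccv: "\<And>x. x \<in> Ux \<Longrightarrow> strictly_convex_on Uz (\<lambda>z. - F (x, z))"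
    using assms(2) unfolding strictly_convex_concave_on_def strictly_concave_on_def by blast
  obtain x z x' z' where pq: "p = (x, z)" "q = (x', z')" by fastforce
  then have mem: "x \<in> Ux" "z \<in> Uz" "x' \<in> Ux" "z' \<in> Uz" using assms(3,4) U by auto
  have crit: "GDERIV (\<lambda>x. F (x, z)) x :> 0" "GDERIV (\<lambda>x. F (x, z')) x' :> 0"
    "GDERIV (\<lambda>z. - F (x, z)) z :> 0" "GDERIV (\<lambda>z. - F (x', z)) z' :> 0"
    using C2_GDERIV_slices[OF assms(1)] GDERIV_minus assms(5,6) unfolding pq
    by (metis fst_zero snd_zero minus_zero)+
  note less = strictly_convex_critical_point_less
  have "x' \<noteq> x \<Longrightarrow> F (x, z) < F (x', z)" "x' \<noteq> x \<Longrightarrow> F (x', z') < F (x, z')"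
    "z' \<noteq> z \<Longrightarrow> F (x, z') < F (x, z)" "z' \<noteq> z \<Longrightarrow> F (x', z) < F (x', z')"
    using less[OF cvx crit(1), of x'] less[OF cvx crit(2), of x]
      less[OF ccv crit(3), of z'] less[OF ccv crit(4), of z] mem by auto
  then have "x' = x \<and> z' = z" by (metis less_asym less_trans)
  then show ?thesis unfolding pq by simp
qed

section \<open>A scalar differential inequality with extinction in fixed time\<close>

text \<open>
  Suppose that \<open>V\<close> is still positive at the late time. Since \<open>b > 1\<close>, the power \<open>V\<^sup>1\<^sup>-\<^sup>b\<close> grows at
  least at the rate \<open>k2 (b - 1)\<close> from a positive initial value, hence exceeds 1 after the time
  \<open>1 / (k2 (b - 1))\<close>, however large \<open>V\<close> was initially; that is, \<open>V < 1\<close> by then. Since \<open>a < 1\<close>, the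
  power \<open>V\<^sup>1\<^sup>-\<^sup>a\<close> falls at least at the rate \<open>k1 (1 - a)\<close>, so from a value below 1 it cannot remain
  positive for the time \<open>1 / (k1 (1 - a))\<close>.
\<close>
lemma fixed_time_extinction:
  fixes V V' :: "real \<Rightarrow> real" and a b k1 k2 :: real
  assumes cont: "continuous_on {0..} V" and nonneg: "\<And>t. t \<ge> 0 \<Longrightarrow> V t \<ge> 0"
    and der: "\<And>t. t > 0 \<Longrightarrow> (V has_real_derivative V' t) (at t)"
    and decay: "\<And>t. t > 0 \<Longrightarrow> V' t \<le> - (k1 * V t powr a + k2 * V t powr b)"
    and k: "k1 > 0" "k2 > 0" and ab: "a < 1" "1 < b"
    and late: "t \<ge> 1 / (k2 * (b - 1)) + 1 / (k1 * (1 - a))"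
  shows "V t = 0"
proof (rule ccontr)
  assume "V t \<noteq> 0"
  define T1 T2 where "T1 = 1 / (k2 * (b - 1))" and "T2 = 1 / (k1 * (1 - a))"
  have T: "T1 > 0" "T2 > 0" "T1 + T2 \<le> t"
    using k ab late by (simp_all add: T1_def T2_def)
  have Vt: "V t > 0" using \<open>V t \<noteq> 0\<close> nonneg[of t] T by simp
  \<comment> \<open>\<open>V\<close> is nonincreasing, so it is positive on all of \<open>{0..t}\<close> and its powers are differentiable.\<close>
  have pos: "V s > 0" if s: "0 \<le> s" "s \<le> t" for s
  proof -
    have "V t \<le> V s"
    proof (rule DERIV_nonpos_imp_decreasing_open[OF \<open>s \<le> t\<close>])
      fix u assume u: "s < u" "u < t"
      have "0 \<le> k1 * V u powr a + k2 * V u powr b" using k by simp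
      then have "V' u \<le> 0" using decay[of u] u s by linarith
      then show "\<exists>y. DERIV V u :> y \<and> y \<le> 0" using der[of u] u s by auto
    next
      show "continuous_on {s..t} V" using cont by (rule continuous_on_subset) (use s in auto)
    qed
    with Vt show ?thesis by simp
  qed
  have cpow: "continuous_on {r..s} (\<lambda>u. V u powr e)" if "0 \<le> r" "s \<le> t" for r s e
  proof -
    have "V u > 0" if "u \<in> {r..s}" for u
      using pos[of u] that \<open>0 \<le> r\<close> \<open>s \<le> t\<close> by auto
    moreover have "continuous_on {r..s} V"
      using cont by (rule continuous_on_subset) (use that in auto)
    ultimately show ?thesis by (intro continuous_on_powr continuous_on_const) (auto simp: less_le)
  qed
  have dpow: "((\<lambda>u. V u powr (1 - e)) has_real_derivative (1 - e) * V u powr (- e) * V' u) (at u)"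
    if "0 < u" "u \<le> t" for u e
    using DERIV_fun_powr[OF der, of u "1 - e"] pos[of u] that by simp
  have cancel: "V u powr (- e) * V u powr e = 1" if "0 \<le> u" "u \<le> t" for u e
    using pos[OF that] by (simp add: powr_minus)
  \<comment> \<open>The growth of \<open>V\<^sup>1\<^sup>-\<^sup>b\<close> is stated as the decrease of its defect against the linear bound.\<close>
  define P where "P u = k2 * (b - 1) * u - V u powr (1 - b)" for u
  have "P T1 \<le> P 0"
  proof (rule DERIV_nonpos_imp_decreasing_open[where f = P])
    fix u assume u: "0 < u" "u < T1"
    have "0 \<le> k1 * V u powr a" using k by simp
    then have "V' u \<le> - (k2 * V u powr b)" using decay[of u] u by linarith
    then have "V u powr (- b) * V' u \<le> V u powr (- b) * - (k2 * V u powr b)"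
      by (rule mult_left_mono) simp
    also have "\<dots> = - k2" using cancel[of u b] u T by (simp add: mult.left_commute)
    finally have "(b - 1) * (V u powr (- b) * V' u) \<le> (b - 1) * - k2"
      by (rule mult_left_mono) (use ab in simp)
    then have "k2 * (b - 1) - (1 - b) * V u powr (- b) * V' u \<le> 0"
      by (simp add: algebra_simps)
    moreover have "(P has_real_derivative
        k2 * (b - 1) - (1 - b) * V u powr (- b) * V' u) (at u)"
      unfolding P_def[abs_def] by (rule DERIV_diff[OF DERIV_cmult_Id dpow]) (use u T in auto)
    ultimately show "\<exists>y. DERIV P u :> y \<and> y \<le> 0" by blast
  qed (use T in \<open>auto simp: P_def[abs_def] intro!: continuous_intros cpow\<close>)
  then have "1 + V 0 powr (1 - b) \<le> V T1 powr (1 - b)" using k ab by (simp add: P_def T1_def)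
  moreover have "V 0 powr (1 - b) > 0" using pos[of 0] T by simp
  ultimately have "V T1 powr (1 - b) > 1" by linarith
  then have "V T1 < 1"
    using powr_mono2'[of "b - 1" 1 "V T1"] powr_mono2'[of "1 - b" 1 "V T1"] ab by force
  define Q where "Q u = k1 * (1 - a) * u + V u powr (1 - a)" for u
  have "Q t \<le> Q T1"
  proof (rule DERIV_nonpos_imp_decreasing_open[where f = Q])
    fix u assume u: "T1 < u" "u < t"
    then have u0: "0 < u" using T by simp
    have "0 \<le> k2 * V u powr b" using k by simp
    then have "V' u \<le> - (k1 * V u powr a)" using decay[of u] u0 by linarith
    then have "V u powr (- a) * V' u \<le> V u powr (- a) * - (k1 * V u powr a)"
      by (rule mult_left_mono) simp
    also have "\<dots> = - k1" using cancel[of u a] u u0 by (simp add: mult.left_commute)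
    finally have "(1 - a) * (V u powr (- a) * V' u) \<le> (1 - a) * - k1"
      by (rule mult_left_mono) (use ab in simp)
    then have "k1 * (1 - a) + (1 - a) * V u powr (- a) * V' u \<le> 0"
      by (simp add: algebra_simps)
    moreover have "(Q has_real_derivative
        k1 * (1 - a) + (1 - a) * V u powr (- a) * V' u) (at u)"
      unfolding Q_def[abs_def] by (rule DERIV_add[OF DERIV_cmult_Id dpow]) (use u u0 in auto)
    ultimately show "\<exists>y. DERIV Q u :> y \<and> y \<le> 0" by blast
  qed (use T in \<open>auto simp: Q_def[abs_def] intro!: continuous_intros cpow\<close>)
  moreover have "1 \<le> k1 * (1 - a) * (t - T1)"
  proof -
    have "k1 * (1 - a) * T2 = 1" using k ab by (simp add: T2_def)
    then show ?thesis
      using mult_left_mono[of T2 "t - T1" "k1 * (1 - a)"] k ab T by simp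
  qed
  moreover have "V T1 powr (1 - a) \<le> 1"
    using powr_mono2[of "1 - a" "V T1" 1] \<open>V T1 < 1\<close> pos[of T1] T ab by simp
  moreover have "V t powr (1 - a) > 0" using Vt by simp
  ultimately show False by (simp add: Q_def algebra_simps)
qed

section \<open>Dynamics of the Newton flow\<close>

text \<open>
  The set \<open>{p \<in> U. V p \<le> c}\<close> is closed because it is compact, and every point of it has a neighborhood
  in \<open>U\<close>. At the first exit time \<open>t0\<close> the curve is still in the set by closedness; for a moment longer
  it is in \<open>U\<close> by openness, where \<open>V\<close> cannot increase, so it has not left the set either.
\<close>
lemma compact_sublevel_set_forward_invariant:
  fixes w :: "real \<Rightarrow> 'a::euclidean_space" and V :: "'a \<Rightarrow> real"
  assumes "open U" and S: "S = {p \<in> U. V p \<le> c}" "compact S"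
    and cont: "continuous_on {0..} w" and "w 0 \<in> S"
    and der: "\<And>t. t \<ge> 0 \<Longrightarrow> w t \<in> U \<Longrightarrow>
      \<exists>y \<le> 0. ((\<lambda>t. V (w t)) has_real_derivative y) (at t within {0..})"
    and "t \<ge> 0"
  shows "w t \<in> S"
proof (rule ccontr)
  assume "w t \<notin> S"
  define B where "B = {t. t \<ge> 0 \<and> w t \<notin> S}"
  define t0 where "t0 = Inf B"
  have B: "B \<noteq> {}" "bdd_below B"
    using \<open>w t \<notin> S\<close> \<open>t \<ge> 0\<close> unfolding B_def by (auto intro!: bdd_belowI[of _ 0])
  have t0: "t0 \<ge> 0" unfolding t0_def using B(1) by (intro cInf_greatest) (auto simp: B_def)
  have before: "w s \<in> S" if "0 \<le> s" "s < t0" for s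
    using cInf_lower[OF _ B(2), of s] that unfolding t0_def B_def by force
  have "w t0 \<in> S"
  proof (cases "t0 = 0")
    case False
    then have t0pos: "0 < t0" using t0 by simp
    have "closed ({0..} \<inter> w -` S)"
      using continuous_closed_preimage[OF cont] compact_imp_closed[OF S(2)] by auto
    moreover have "{0..<t0} \<subseteq> {0..} \<inter> w -` S" using before by auto
    ultimately have "closure {0..<t0} \<subseteq> {0..} \<inter> w -` S" by (intro closure_minimal)
    moreover have "t0 \<in> closure {0..<t0}" using t0pos by simp
    ultimately show ?thesis by blast
  qed (use \<open>w 0 \<in> S\<close> in simp)
  then have "w t0 \<in> U" using S by auto
  then obtain d where d: "d > 0" "\<And>s. s \<ge> 0 \<Longrightarrow> dist s t0 < d \<Longrightarrow> w s \<in> U"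
  proof -
    obtain e where e: "e > 0" "ball (w t0) e \<subseteq> U"
      using \<open>open U\<close> \<open>w t0 \<in> U\<close> open_contains_ball by blast
    then obtain d where "d > 0" "\<forall>s\<in>{0..}. dist s t0 < d \<longrightarrow> dist (w s) (w t0) < e"
      using cont t0 unfolding continuous_on_iff by (metis atLeast_iff)
    then show thesis using that[of d] e by (auto simp: dist_commute subset_iff)
  qed
  have after: "w s \<in> S" if s: "t0 \<le> s" "s < t0 + d" for s
  proof -
    have inU: "w u \<in> U" if "t0 \<le> u" "u \<le> s" for u
      using d(2)[of u] that s t0 by (simp add: dist_real_def)
    have "V (w s) \<le> V (w t0)"
    proof (rule DERIV_nonpos_imp_decreasing_open[OF s(1)])
      fix u assume u: "t0 < u" "u < s"
      then have "at u within {0..} = at u" using t0 by (intro at_within_interior) auto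
      then show "\<exists>y. DERIV (\<lambda>t. V (w t)) u :> y \<and> y \<le> 0"
        using der[of u] inU[of u] u t0 by auto
    next
      show "continuous_on {t0..s} (\<lambda>t. V (w t))"
        unfolding continuous_on_eq_continuous_within
      proof
        fix u assume u: "u \<in> {t0..s}"
        then obtain y where "((\<lambda>t. V (w t)) has_real_derivative y) (at u within {0..})"
          using der[of u] inU[of u] t0 by auto
        then have "continuous (at u within {0..}) (\<lambda>t. V (w t))" by (rule DERIV_continuous)
        then show "continuous (at u within {t0..s}) (\<lambda>t. V (w t))"
          by (rule continuous_within_subset) (use t0 in auto)
      qed
    qed
    then show ?thesis using \<open>w t0 \<in> S\<close> inU[of s] s S by auto
  qed
  have "t0 + d \<le> s" if "s \<in> B" for s
  proof (rule ccontr)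
    assume "\<not> t0 + d \<le> s"
    then have "w s \<in> S" using before[of s] after[of s] that by (cases "s < t0") (auto simp: B_def)
    then show False using that by (simp add: B_def)
  qed
  then have "t0 + d \<le> t0" unfolding t0_def using B(1) by (intro cInf_greatest) auto
  with d show False by simp
qed

text \<open>
  Multiplying the field by the Hessian leaves a vector parallel to the gradient \<open>g\<close>, and the powers
  become \<open>\<parallel>g\<parallel>\<^sup>2 / \<parallel>g\<parallel> powr ((q-2)/(q-1)) = (\<parallel>g\<parallel>\<^sup>2) powr (q/(2(q-1)))\<close>. At critical points both sides are 0,
  by the convention for the field on the left and because \<open>0 powr e = 0\<close> on the right.
\<close>
lemma inner_grad_hessian_newton_field:
  assumes "C2 F" "surj (hessian F p)" "p1 \<noteq> 1" "p2 \<noteq> 1"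
  shows "grad F p \<bullet> hessian F p (newton_field F c1 c2 p1 p2 p) =
    - (c1 * (2 * lyapunov F p) powr (p1 / (2 * (p1 - 1))) +
       c2 * (2 * lyapunov F p) powr (p2 / (2 * (p2 - 1))))"
proof (cases "grad F p = 0")
  case True
  then show ?thesis by (simp add: lyapunov_def)
next
  case False
  define g where "g = grad F p"
  have lin: "linear (hessian F p)"
    using C2_grad_has_derivative[OF assms(1)] has_derivative_linear by blast
  have weight: "c * (norm g)\<^sup>2 / norm g powr ((q - 2) / (q - 1)) = c * (2 * lyapunov F p) powr (q / (2 * (q - 1)))"
    if "q \<noteq> 1" for c q :: real
  proof -
    have "2 - (q - 2) / (q - 1) = 2 * (q / (2 * (q - 1)))" using that by (simp add: field_simps)
    then have "norm g powr 2 / norm g powr ((q - 2) / (q - 1)) = (norm g powr 2) powr (q / (2 * (q - 1)))"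
      by (metis powr_diff powr_powr)
    moreover have "2 * lyapunov F p = (norm g)\<^sup>2" by (simp add: lyapunov_def g_def)
    moreover have "norm g powr 2 = (norm g)\<^sup>2" using False by (simp add: g_def powr_numeral)
    ultimately show ?thesis by (metis times_divide_eq_right)
  qed
  have residual: "hessian F p (newton_field F c1 c2 p1 p2 p) =
    - (c1 *\<^sub>R (g /\<^sub>R (norm g powr ((p1 - 2) / (p1 - 1)))) +
       c2 *\<^sub>R (g /\<^sub>R (norm g powr ((p2 - 2) / (p2 - 1)))))"
    using False assms(2) lin
    by (simp add: newton_field_def Let_def g_def linear_neg surj_f_inv_f)
  have "g \<bullet> hessian F p (newton_field F c1 c2 p1 p2 p) =
    - (c1 * (norm g)\<^sup>2 / norm g powr ((p1 - 2) / (p1 - 1)) +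
       c2 * (norm g)\<^sup>2 / norm g powr ((p2 - 2) / (p2 - 1)))"
    unfolding residual 
    by (simp add: inner_add_right inner_diff_right power2_norm_eq_inner divide_inverse mult_ac)
  then show ?thesis using weight assms(3,4) by (simp add: g_def)
qed

lemma lyapunov_along_trajectory:
  assumes "C2 F" "trajectory (newton_field F c1 c2 p1 p2) w" "t \<ge> 0" "surj (hessian F (w t))"
    and "p1 \<noteq> 1" "p2 \<noteq> 1"
  shows "((\<lambda>t. lyapunov F (w t)) has_real_derivative
    - (c1 * (2 * lyapunov F (w t)) powr (p1 / (2 * (p1 - 1))) +
       c2 * (2 * lyapunov F (w t)) powr (p2 / (2 * (p2 - 1))))) (at t within {0..})"
proof -
  let ?f = "newton_field F c1 c2 p1 p2"
  have lin: "hessian F (w t) (k *\<^sub>R v) = k *\<^sub>R hessian F (w t) v" for k v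
    using C2_grad_has_derivative[OF assms(1)] has_derivative_linear linear_scale by blast
  have "(w has_derivative (\<lambda>h. h *\<^sub>R ?f (w t))) (at t within {0..})"
    using assms(2,3) unfolding trajectory_def has_vector_derivative_def by blast
  from has_derivative_compose[OF this C2_grad_has_derivative[OF assms(1)]]
  have d: "((\<lambda>t. grad F (w t)) has_derivative (\<lambda>h. h *\<^sub>R hessian F (w t) (?f (w t)))) (at t within {0..})"
    by (simp add: lin)
  have "((\<lambda>t. (grad F (w t) \<bullet> grad F (w t)) / 2) has_real_derivative
      grad F (w t) \<bullet> hessian F (w t) (?f (w t))) (at t within {0..})"
    unfolding has_field_derivative_def
    by (rule has_derivative_eq_rhs, (rule derivative_intros d)+)
      (auto simp: inner_commute)
  then show ?thesis
    using inner_grad_hessian_newton_field[OF assms(1,4,5,6), of c1 c2]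
    by (simp add: lyapunov_def power2_norm_eq_inner)
qed

text \<open>
  The factor 2 in \<open>2 V = \<parallel>g\<parallel>\<^sup>2\<close> is absorbed into the rates \<open>k1\<close> and \<open>k2\<close>. For exponents above 1, the conditions \<open>p1 > 2\<close> and
  \<open>p2 < 2\<close> are exactly what puts the powers \<open>a\<close> and \<open>b\<close> of \<open>V\<close> on different sides of 1.
\<close>
theorem theorem5:
  fixes F :: "(real ^ 'n) \<times> (real ^ 'm) \<Rightarrow> real"
    and xs :: "real ^ 'n" and zs :: "real ^ 'm"
    and U D :: "((real ^ 'n) \<times> (real ^ 'm)) set"
    and c1 c2 p1 p2 :: real
  assumes "C2 F"
    and "saddle_point F xs zs"
    and "open U" and "(xs, zs) \<in> U"
    and "strictly_convex_concave_on U F"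
    and "\<And>p. p \<in> U \<Longrightarrow> pos_def (hessian_xx F p)"
    and "\<And>p. p \<in> U \<Longrightarrow> neg_def (hessian_zz F p)"
    and "c1 > 0" and "c2 > 0" and "p1 > 2" and "1 < p2" and "p2 < 2"
    and "D = largest_compact_sublevel_set (lyapunov F) U"
  shows "fixed_time_convergent (newton_field F c1 c2 p1 p2) D (xs, zs) \<and>
    (U = UNIV \<longrightarrow> fixed_time_convergent (newton_field F c1 c2 p1 p2) UNIV (xs, zs))"
proof -
  let ?f = "newton_field F c1 c2 p1 p2" and ?V = "lyapunov F"
  define a b where "a = p1 / (2 * (p1 - 1))" and "b = p2 / (2 * (p2 - 1))"
  define k1 k2 where "k1 = c1 * 2 powr a" and "k2 = c2 * 2 powr b"
  have ab: "a < 1" "1 < b" using assms(10-12) by (simp_all add: a_def b_def field_simps)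
  have k: "k1 > 0" "k2 > 0" using assms(8,9) by (simp_all add: k1_def k2_def)
  define T where "T = 1 / (k2 * (b - 1)) + 1 / (k1 * (1 - a))"
  have T: "T \<ge> 0" using k ab by (simp add: T_def)
  have der: "((\<lambda>t. ?V (w t)) has_real_derivative - (k1 * ?V (w t) powr a + k2 * ?V (w t) powr b))
      (at t within {0..})" if "trajectory ?f w" "t \<ge> 0" "w t \<in> U" for w t
  proof -
    have "surj (hessian F (w t))"
      using hessian_surj_of_definite_blocks assms(1,6,7) that(3) by blast
    from lyapunov_along_trajectory[OF assms(1) that(1,2) this] show ?thesis
      using assms(10,11) by (simp add: a_def b_def k1_def k2_def powr_mult mult.assoc)
  qed
  have reach: "w t = (xs, zs)"
    if w: "trajectory ?f w" "\<And>t. t \<ge> 0 \<Longrightarrow> w t \<in> U" and t: "t \<ge> T" for w t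
  proof -
    have "?V (w t) = 0"
    proof (rule fixed_time_extinction[where V = "\<lambda>t. ?V (w t)"])
      show "continuous_on {0..} (\<lambda>t. ?V (w t))"
        using der[OF w(1)] w(2) by (intro DERIV_continuous_on) auto
      show "((\<lambda>t. ?V (w t)) has_real_derivative - (k1 * ?V (w t) powr a + k2 * ?V (w t) powr b)) (at t)"
        if "t > 0" for t
        using der[OF w(1), of t] w(2)[of t] that by (simp add: at_within_interior[of t "{0..}"])
      show "t \<ge> 1 / (k2 * (b - 1)) + 1 / (k1 * (1 - a))" using t by (simp add: T_def)
    qed (use k ab in \<open>auto simp: lyapunov_def\<close>)
    then have "grad F (w t) = 0" by (simp add: lyapunov_def)
    moreover have "w t \<in> U" using w(2) t T by simp
    ultimately show ?thesis
      using strictly_convex_concave_critical_point_unique[OF assms(1,5)] assms(4)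
        saddle_point_grad_eq_0[OF assms(1,2)] by blast
  qed
  have stay: "w t \<in> U" if w: "trajectory ?f w" "w 0 \<in> D" and t: "t \<ge> 0" for w t
  proof -
    obtain c where S: "compact {p \<in> U. ?V p \<le> c}" "w 0 \<in> {p \<in> U. ?V p \<le> c}"
      using w(2) assms(13) unfolding largest_compact_sublevel_set_def sublevel_set_def by blast
    have cont: "continuous_on {0..} w"
      using w(1) has_vector_derivative_continuous unfolding trajectory_def
      by (fastforce simp: continuous_on_eq_continuous_within)
    have "\<exists>y \<le> 0. ((\<lambda>t. ?V (w t)) has_real_derivative y) (at t within {0..})"
      if "t \<ge> 0" "w t \<in> U" for t
    proof -
      have "0 \<le> k1 * ?V (w t) powr a + k2 * ?V (w t) powr b" using k by simp
      then have "- (k1 * ?V (w t) powr a + k2 * ?V (w t) powr b) \<le> 0" by linarith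
      then show ?thesis using der[OF w(1) that] by blast
    qed
    from compact_sublevel_set_forward_invariant[OF assms(3) refl S(1) cont S(2) this t]
    show ?thesis by auto
  qed
  show ?thesis unfolding fixed_time_convergent_def using reach stay T by (metis UNIV_I)
qed

end
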